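(* There is a universal constant $C>0$ such that for every positive integer $n$ and every symmetric Boolean function $f:\{-1,1\}^n\to\{-1,1\}$, $$\log\left(\|\widehat{f}\|_{1,1/3}\right)\le C\,\widetilde{\deg}(f),$$ i.e. $\log(\|\widehat f\|_{1,1/3})=O(\widetilde{\deg}(f))$.
   Context: $f:\{-1,1\}^n\to\{-1,1\}$ is symmetric if $f(x_1,\dots,x_n)=f(x_{\sigma(1)},\dots,x_{\sigma(n)})$ for all $x$ and all $\sigma\in S_n$. Every function $p:\{-1,1\}^n\to\mathbb{R}$ has a unique multilinear expression $p(x)=\sum_{S\subseteq[n]}a_S\prod_{i\in S}x_i$; its spectral norm is $\|p\|_1=\sum_S|a_S|$. The approximate spectral norm $\|\widehat f\|_{1,\epsilon}$ is the minimum of $\|p\|_1$ over real polynomials $p:\{-1,1\}^n\to\mathbb{R}$ with $|p(x)-f(x)|\le\epsilon$ for all $x\in\{-1,1\}^n$. $\widetilde{\deg}(f)$ is the minimum degree of a real polynomial $p$ with $|p(x)-f(x)|\le 1/3$ for all $x\in\{-1,1\}^n$. Logarithms are base 2. *)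

theory Defs
  imports
    Complex_Main
    "HOL-Library.FuncSet"
    "HOL-Library.Poly_Mapping"
    "HOL-Combinatorics.Permutations"
begin

(* Coordinates are indexed by {..<n}; points of the cube are extensional, so that each
   point of {-1,1}^n is represented by exactly one function.  Functions on the cube have
   type (nat \<Rightarrow> real) \<Rightarrow> real, and only their values on the cube n are ever used. *)
definition cube :: "nat \<Rightarrow> (nat \<Rightarrow> real) set" where
  "cube n = {..<n} \<rightarrow>\<^sub>E {-1, 1}"

definition boolean_function :: "nat \<Rightarrow> ((nat \<Rightarrow> real) \<Rightarrow> real) \<Rightarrow> bool" where
  "boolean_function n f \<longleftrightarrow> (\<forall>x\<in>cube n. f x \<in> {-1, 1})"

definition symmetric_function :: "nat \<Rightarrow> ((nat \<Rightarrow> real) \<Rightarrow> real) \<Rightarrow> bool" where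
  "symmetric_function n f \<longleftrightarrow>
     (\<forall>\<sigma>. \<sigma> permutes {..<n} \<longrightarrow> (\<forall>x\<in>cube n. f x = f (\<lambda>i. x (\<sigma> i))))"

definition approximates ::
  "nat \<Rightarrow> real \<Rightarrow> ((nat \<Rightarrow> real) \<Rightarrow> real) \<Rightarrow> ((nat \<Rightarrow> real) \<Rightarrow> real) \<Rightarrow> bool" where
  "approximates n \<epsilon> p f \<longleftrightarrow> (\<forall>x\<in>cube n. \<bar>p x - f x\<bar> \<le> \<epsilon>)"

definition is_multilinear_expression ::
  "nat \<Rightarrow> ((nat \<Rightarrow> real) \<Rightarrow> real) \<Rightarrow> (nat set \<Rightarrow> real) \<Rightarrow> bool" where
  "is_multilinear_expression n p a \<longleftrightarrow>
     (\<forall>x\<in>cube n. p x = (\<Sum>S\<in>Pow {..<n}. a S * (\<Prod>i\<in>S. x i))) \<and>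
     (\<forall>S. \<not> S \<subseteq> {..<n} \<longrightarrow> a S = 0)"

lemma sum_characters_cube:
  assumes "S \<subseteq> {..<n}" "T \<subseteq> {..<n}"
  shows "(\<Sum>x\<in>cube n. (\<Prod>i\<in>S. x i) * (\<Prod>i\<in>T. x i)) = (if S = T then 2 ^ n else 0)"
proof -
  let ?g = "\<lambda>i (y::real). (if i \<in> S then y else 1) * (if i \<in> T then y else 1)"
  have ext: "(\<Prod>i\<in>U. x i) = (\<Prod>i<n. if i \<in> U then x i else 1)"
    if "U \<subseteq> {..<n}" for U and x :: "nat \<Rightarrow> real"
  proof -
    have "{..<n} \<inter> U = U" using that by blast
    then show ?thesis
      by (metis (no_types) finite_lessThan prod.inter_restrict)
  qed
  have "(\<Sum>x\<in>cube n. (\<Prod>i\<in>S. x i) * (\<Prod>i\<in>T. x i)) = (\<Sum>x\<in>cube n. \<Prod>i<n. ?g i (x i))"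
    by (simp only: ext[OF assms(1)] ext[OF assms(2)] prod.distrib)
  also have "\<dots> = (\<Prod>i<n. \<Sum>y\<in>{-1, 1}. ?g i y)"
    unfolding cube_def by (rule prod_sum_PiE[symmetric]) auto
  also have "\<dots> = (\<Prod>i<n. if i \<in> S \<longleftrightarrow> i \<in> T then 2 else 0)"
    by (rule prod.cong) auto
  also have "\<dots> = (if S = T then 2 ^ n else 0)"
    using assms by (auto simp: prod_zero_iff)
  finally show ?thesis .
qed

lemma sum_characters_Pow:
  assumes "x \<in> cube n" "y \<in> cube n"
  shows "(\<Sum>S\<in>Pow {..<n}. (\<Prod>i\<in>S. x i) * (\<Prod>i\<in>S. y i)) = (if x = y then 2 ^ n else 0)"
proof -
  have "(\<Sum>S\<in>Pow {..<n}. (\<Prod>i\<in>S. x i) * (\<Prod>i\<in>S. y i)) = (\<Prod>i<n. x i * y i + 1)"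
    by (simp add: prod_add prod.distrib)
  also have "\<dots> = (\<Prod>i<n. if x i = y i then 2 else 0)"
  proof (intro prod.cong refl)
    fix i assume "i \<in> {..<n}"
    then have "x i \<in> {-1, 1}" "y i \<in> {-1, 1}"
      using assms by (auto simp only: cube_def dest: PiE_mem)
    then show "x i * y i + 1 = (if x i = y i then 2 else 0)" by auto
  qed
  also have "\<dots> = (if x = y then 2 ^ n else 0)"
  proof (cases "x = y")
    case False
    then have "\<exists>i<n. x i \<noteq> y i"
      using assms unfolding cube_def by (metis PiE_ext lessThan_iff)
    then show ?thesis using False by auto
  qed simp
  finally show ?thesis .
qed

lemma finite_cube: "finite (cube n)"
  unfolding cube_def by (intro finite_PiE) auto

lemma ex1_multilinear_expression: "\<exists>!a. is_multilinear_expression n p a"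
proof (rule ex_ex1I)
  let ?a = "\<lambda>S. if S \<subseteq> {..<n} then (\<Sum>y\<in>cube n. p y * (\<Prod>i\<in>S. y i)) / 2 ^ n else 0"
  have "p x = (\<Sum>S\<in>Pow {..<n}. ?a S * (\<Prod>i\<in>S. x i))" if x: "x \<in> cube n" for x
  proof -
    have "(\<Sum>S\<in>Pow {..<n}. ?a S * (\<Prod>i\<in>S. x i))
      = (\<Sum>S\<in>Pow {..<n}. \<Sum>y\<in>cube n. p y / 2 ^ n * ((\<Prod>i\<in>S. x i) * (\<Prod>i\<in>S. y i)))"
      by (intro sum.cong refl)
         (simp add: sum_divide_distrib sum_distrib_left sum_distrib_right mult_ac)
    also have "\<dots> = (\<Sum>y\<in>cube n. p y / 2 ^ n * (\<Sum>S\<in>Pow {..<n}. (\<Prod>i\<in>S. x i) * (\<Prod>i\<in>S. y i)))"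
      by (subst sum.swap) (simp add: sum_distrib_left)
    also have "\<dots> = (\<Sum>y\<in>cube n. if x = y then p y else 0)"
      by (intro sum.cong refl) (simp add: sum_characters_Pow[OF x])
    also have "\<dots> = p x"
      using x finite_cube by simp
    finally show ?thesis by simp
  qed
  then show "\<exists>a. is_multilinear_expression n p a"
    unfolding is_multilinear_expression_def by (intro exI[of _ ?a]) simp
next
  have coeff: "a T = (\<Sum>x\<in>cube n. p x * (\<Prod>i\<in>T. x i)) / 2 ^ n"
    if a: "is_multilinear_expression n p a" and T: "T \<subseteq> {..<n}" for a T
  proof -
    have "(\<Sum>x\<in>cube n. p x * (\<Prod>i\<in>T. x i))
      = (\<Sum>x\<in>cube n. \<Sum>S\<in>Pow {..<n}. a S * ((\<Prod>i\<in>S. x i) * (\<Prod>i\<in>T. x i)))"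
      using a unfolding is_multilinear_expression_def
      by (intro sum.cong refl) (simp add: sum_distrib_right mult.assoc)
    also have "\<dots> = (\<Sum>S\<in>Pow {..<n}. a S * (\<Sum>x\<in>cube n. (\<Prod>i\<in>S. x i) * (\<Prod>i\<in>T. x i)))"
      by (subst sum.swap) (simp add: sum_distrib_left)
    also have "\<dots> = (\<Sum>S\<in>Pow {..<n}. if S = T then a S * 2 ^ n else 0)"
      by (intro sum.cong refl) (simp add: sum_characters_cube T)
    also have "\<dots> = a T * 2 ^ n"
      using T by simp
    finally show ?thesis by simp
  qed
  fix a b assume a: "is_multilinear_expression n p a" and b: "is_multilinear_expression n p b"
  show "a = b"
  proof
    fix S show "a S = b S"
    proof (cases "S \<subseteq> {..<n}")
      case True
      then show ?thesis using coeff[OF a] coeff[OF b] by simp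
    next
      case False
      then show ?thesis using a b unfolding is_multilinear_expression_def by simp
    qed
  qed
qed

definition multilinear_coeff :: "nat \<Rightarrow> ((nat \<Rightarrow> real) \<Rightarrow> real) \<Rightarrow> nat set \<Rightarrow> real" where
  "multilinear_coeff n p = (THE a. is_multilinear_expression n p a)"

definition spectral_norm :: "nat \<Rightarrow> ((nat \<Rightarrow> real) \<Rightarrow> real) \<Rightarrow> real" where
  "spectral_norm n p = (\<Sum>S\<in>Pow {..<n}. \<bar>multilinear_coeff n p S\<bar>)"

(* The infimum is a minimum: f itself approximates f, and the spectral norm is a norm on the
   finite-dimensional space of functions on the cube, in which the approximants of f form a
   closed set.  Every function on the cube is a polynomial, so p ranges over all functions. *)
definition approx_spectral_norm :: "nat \<Rightarrow> ((nat \<Rightarrow> real) \<Rightarrow> real) \<Rightarrow> real \<Rightarrow> real" where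
  "approx_spectral_norm n f \<epsilon> = Inf {spectral_norm n p |p. approximates n \<epsilon> p f}"

(* Real polynomials in the variables x_i, i \<in> nat: a polynomial maps exponent vectors
   (monomials) to coefficients, and Poly_Mapping.keys P is the
   set of monomials occurring in P. *)
type_synonym real_mpoly = "(nat \<Rightarrow>\<^sub>0 nat) \<Rightarrow>\<^sub>0 real"

definition mpoly_in :: "nat \<Rightarrow> real_mpoly \<Rightarrow> bool" where
  "mpoly_in n P \<longleftrightarrow> (\<forall>m\<in>Poly_Mapping.keys P. Poly_Mapping.keys m \<subseteq> {..<n})"

definition mpoly_eval :: "real_mpoly \<Rightarrow> (nat \<Rightarrow> real) \<Rightarrow> real" where
  "mpoly_eval P x = (\<Sum>m\<in>Poly_Mapping.keys P.
     Poly_Mapping.lookup P m * (\<Prod>i\<in>Poly_Mapping.keys m. x i ^ Poly_Mapping.lookup m i))"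

(* Total degree; the zero polynomial gets degree 0. *)
definition mpoly_degree :: "real_mpoly \<Rightarrow> nat" where
  "mpoly_degree P = Max (insert 0
     ((\<lambda>m. \<Sum>i\<in>Poly_Mapping.keys m. Poly_Mapping.lookup m i) ` Poly_Mapping.keys P))"

definition approx_degree :: "nat \<Rightarrow> ((nat \<Rightarrow> real) \<Rightarrow> real) \<Rightarrow> nat" where
  "approx_degree n f =
     (LEAST d. \<exists>P. mpoly_in n P \<and> approximates n (1/3) (mpoly_eval P) f \<and> mpoly_degree P = d)"

end

theory Submission
  imports Defs "HOL-Computational_Algebra.Polynomial"
begin

text \<open>
  Averaging an approximating polynomial over the points of the cube with exactly t coordinates
  equal to -1 gives a univariate polynomial q of degree d, the approximate degree, which is bounded
  by 4/3 on 0, ..., n and for which q of the weight still approximates f. Interpolate q at d + 1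
  equally spaced integers in this range. Each linear factor (weight minus node) of an interpolating
  product has spectral norm at most n, while the nodes are at least n/(2d) apart, so submultiplicativity of
  the spectral norm bounds that of q of the weight by 4/3 times (4d)^d / d!, which is at most 16^d
  for d > 0. If d = 0, then f is constant, of spectral norm 1.
\<close>

section \<open>Multilinear coefficients and the spectral norm\<close>

lemma multilinear_expression_coeff: "is_multilinear_expression n p (multilinear_coeff n p)"
  unfolding multilinear_coeff_def by (rule theI'[OF ex1_multilinear_expression])

lemma cube_expansion:
  "x \<in> cube n \<Longrightarrow> p x = (\<Sum>S\<in>Pow {..<n}. multilinear_coeff n p S * (\<Prod>i\<in>S. x i))"
  using multilinear_expression_coeff[of n p] unfolding is_multilinear_expression_def by blast

text \<open>Orthogonality of the characters: multiplying the expansion of \<open>p\<close> by the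
  character of \<open>T\<close> and summing over the cube isolates the coefficient of
  \<open>T\<close>. The formula makes the coefficients visibly linear in \<open>p\<close> and
  dependent only on its values on the cube.\<close>

lemma multilinear_coeff_eq:
  assumes T: "T \<subseteq> {..<n}"
  shows "multilinear_coeff n p T = (\<Sum>x\<in>cube n. p x * (\<Prod>i\<in>T. x i)) / 2 ^ n"
proof -
  let ?a = "multilinear_coeff n p"
  have "(\<Sum>x\<in>cube n. p x * (\<Prod>i\<in>T. x i))
      = (\<Sum>x\<in>cube n. \<Sum>S\<in>Pow {..<n}. ?a S * ((\<Prod>i\<in>S. x i) * (\<Prod>i\<in>T. x i)))"
    by (intro sum.cong refl, subst cube_expansion[of _ n p])
       (simp_all add: sum_distrib_right mult.assoc)
  also have "\<dots> = (\<Sum>S\<in>Pow {..<n}. ?a S * (\<Sum>x\<in>cube n. (\<Prod>i\<in>S. x i) * (\<Prod>i\<in>T. x i)))"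
    by (subst sum.swap) (simp add: sum_distrib_left)
  also have "\<dots> = (\<Sum>S\<in>Pow {..<n}. if S = T then ?a S * 2 ^ n else 0)"
    by (intro sum.cong refl) (simp add: sum_characters_cube T)
  also have "\<dots> = ?a T * 2 ^ n"
    using T by simp
  finally show ?thesis by simp
qed

lemma spectral_norm_nonneg: "0 \<le> spectral_norm n p"
  unfolding spectral_norm_def by (simp add: sum_nonneg)

lemma spectral_norm_cong:
  assumes "\<And>x. x \<in> cube n \<Longrightarrow> p x = q x"
  shows "spectral_norm n p = spectral_norm n q"
  unfolding spectral_norm_def
  by (intro sum.cong refl arg_cong[where f = abs]) (simp add: multilinear_coeff_eq assms)

lemma spectral_norm_add:
  "spectral_norm n (\<lambda>x. p x + q x) \<le> spectral_norm n p + spectral_norm n q"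
proof -
  have "multilinear_coeff n (\<lambda>x. p x + q x) S = multilinear_coeff n p S + multilinear_coeff n q S"
    if "S \<in> Pow {..<n}" for S
    using that by (simp add: multilinear_coeff_eq distrib_right sum.distrib add_divide_distrib)
  then show ?thesis
    unfolding spectral_norm_def by (simp add: sum.distrib[symmetric] sum_mono abs_triangle_ineq)
qed

lemma spectral_norm_cmult: "spectral_norm n (\<lambda>x. c * p x) = \<bar>c\<bar> * spectral_norm n p"
proof -
  have "multilinear_coeff n (\<lambda>x. c * p x) S = c * multilinear_coeff n p S"
    if "S \<in> Pow {..<n}" for S
    using that by (simp add: multilinear_coeff_eq sum_distrib_left mult.assoc)
  then show ?thesis
    unfolding spectral_norm_def by (simp add: sum_distrib_left abs_mult)
qed

lemma spectral_norm_zero: "spectral_norm n (\<lambda>x. 0) = 0"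
  using spectral_norm_cmult[of n 0] by simp

lemma spectral_norm_sum:
  "spectral_norm n (\<lambda>x. \<Sum>k\<in>K. p k x) \<le> (\<Sum>k\<in>K. spectral_norm n (p k))"
proof (induction K rule: infinite_finite_induct)
  case (insert k K)
  then show ?case
    using spectral_norm_add[of n "p k" "\<lambda>x. \<Sum>k\<in>K. p k x"] by simp
qed (simp_all add: spectral_norm_zero)

text \<open>A coordinate common to \<open>S\<close> and \<open>T\<close> contributes a square, which
  is 1 on the cube.\<close>

lemma character_mult:
  fixes x :: "nat \<Rightarrow> real"
  assumes x: "x \<in> cube n" and "S \<subseteq> {..<n}" "T \<subseteq> {..<n}"
  shows "(\<Prod>i\<in>S. x i) * (\<Prod>i\<in>T. x i) = (\<Prod>i\<in>sym_diff S T. x i)"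
proof -
  have fin: "finite S" "finite T"
    using assms(2,3) finite_subset by auto
  have split: "(\<Prod>i\<in>U. x i) = (\<Prod>i\<in>U - V. x i) * (\<Prod>i\<in>U \<inter> V. x i)" if "finite U" for U V
    using prod.subset_diff[of "U \<inter> V" U x] that by (simp add: Diff_Int)
  have "(\<Prod>i\<in>S \<inter> T. x i) * (\<Prod>i\<in>S \<inter> T. x i) = (\<Prod>i\<in>S \<inter> T. 1)"
    unfolding prod.distrib[symmetric]
  proof (rule prod.cong[OF refl])
    fix i assume "i \<in> S \<inter> T"
    then have "x i \<in> {-1, 1}"
      using assms by (auto simp only: cube_def dest: PiE_mem)
    then show "x i * x i = 1" by auto
  qed
  moreover have "(\<Prod>i\<in>sym_diff S T. x i) = (\<Prod>i\<in>S - T. x i) * (\<Prod>i\<in>T - S. x i)"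
    using fin by (intro prod.union_disjoint) auto
  ultimately show ?thesis
    using split[OF fin(1), of T] split[OF fin(2), of S] by (simp add: Int_commute algebra_simps)
qed

text \<open>Multiplication by the character of \<open>S\<close> only permutes the coefficients,
  along the involution \<open>sym_diff S\<close> of the subsets of \<open>{..<n}\<close>.\<close>

lemma spectral_norm_character_mult:
  assumes S: "S \<subseteq> {..<n}"
  shows "spectral_norm n (\<lambda>x. (\<Prod>i\<in>S. x i) * p x) = spectral_norm n p"
proof -
  have "multilinear_coeff n (\<lambda>x. (\<Prod>i\<in>S. x i) * p x) T = multilinear_coeff n p (sym_diff S T)"
    if T: "T \<in> Pow {..<n}" for T
  proof -
    have "sym_diff S T \<subseteq> {..<n}" using S T by auto
    then show ?thesis
      using S T by (simp add: multilinear_coeff_eq character_mult[symmetric] mult_ac)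
  qed
  then have "spectral_norm n (\<lambda>x. (\<Prod>i\<in>S. x i) * p x)
      = (\<Sum>T\<in>Pow {..<n}. \<bar>multilinear_coeff n p (sym_diff S T)\<bar>)"
    by (simp add: spectral_norm_def)
  also have "\<dots> = spectral_norm n p"
    unfolding spectral_norm_def
    by (rule sum.reindex_bij_witness[where i = "sym_diff S" and j = "sym_diff S"]) (use S in auto)
  finally show ?thesis .
qed

text \<open>Only \<open>p\<close> is expanded into characters. Multiplication by a character leaves
  the norm of \<open>q\<close> unchanged, so the triangle inequality gives the sum of the absolute
  coefficients of \<open>p\<close> times the norm of \<open>q\<close>.\<close>

lemma spectral_norm_mult:
  "spectral_norm n (\<lambda>x. p x * q x) \<le> spectral_norm n p * spectral_norm n q"
proof -
  let ?a = "multilinear_coeff n p"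
  have "spectral_norm n (\<lambda>x. p x * q x)
      = spectral_norm n (\<lambda>x. \<Sum>S\<in>Pow {..<n}. ?a S * ((\<Prod>i\<in>S. x i) * q x))"
    by (rule spectral_norm_cong, subst cube_expansion[of _ n p])
       (simp_all add: sum_distrib_right mult.assoc)
  also have "\<dots> \<le> (\<Sum>S\<in>Pow {..<n}. spectral_norm n (\<lambda>x. ?a S * ((\<Prod>i\<in>S. x i) * q x)))"
    by (rule spectral_norm_sum)
  also have "\<dots> = (\<Sum>S\<in>Pow {..<n}. \<bar>?a S\<bar> * spectral_norm n q)"
    by (intro sum.cong refl) (simp add: spectral_norm_cmult spectral_norm_character_mult)
  also have "\<dots> = spectral_norm n p * spectral_norm n q"
    by (simp add: spectral_norm_def sum_distrib_right)
  finally show ?thesis .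
qed

lemma spectral_norm_one: "spectral_norm n (\<lambda>x. 1) = 1"
proof -
  have "multilinear_coeff n (\<lambda>x. 1) S = (if S = {} then 1 else 0)" if "S \<in> Pow {..<n}" for S
    using that sum_characters_cube[of "{}" n S] by (auto simp: multilinear_coeff_eq)
  then have "spectral_norm n (\<lambda>x. 1) = (\<Sum>S\<in>Pow {..<n}. if S = {} then 1 else 0)"
    unfolding spectral_norm_def by (intro sum.cong refl) auto
  then show ?thesis by simp
qed

lemma spectral_norm_const: "spectral_norm n (\<lambda>x. c) = \<bar>c\<bar>"
  using spectral_norm_cmult[of n c "\<lambda>x. 1"] by (simp add: spectral_norm_one)

lemma spectral_norm_coordinate: "i < n \<Longrightarrow> spectral_norm n (\<lambda>x. x i) = 1"
  using spectral_norm_character_mult[of "{i}" n "\<lambda>x. 1"] by (simp add: spectral_norm_one)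

lemma spectral_norm_prod:
  "spectral_norm n (\<lambda>x. \<Prod>k\<in>K. p k x) \<le> (\<Prod>k\<in>K. spectral_norm n (p k))"
proof (induction K rule: infinite_finite_induct)
  case (insert k K)
  have "spectral_norm n (\<lambda>x. p k x * (\<Prod>k\<in>K. p k x))
      \<le> spectral_norm n (p k) * spectral_norm n (\<lambda>x. \<Prod>k\<in>K. p k x)"
    by (rule spectral_norm_mult)
  also have "\<dots> \<le> spectral_norm n (p k) * (\<Prod>k\<in>K. spectral_norm n (p k))"
    by (intro mult_left_mono insert.IH spectral_norm_nonneg)
  finally show ?case using insert.hyps by simp
qed (simp_all add: spectral_norm_one)

section \<open>The weight as an affine function on the cube\<close>

definition weight :: "nat \<Rightarrow> (nat \<Rightarrow> real) \<Rightarrow> nat" where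
  "weight n x = card {i \<in> {..<n}. x i = -1}"

lemma weight_le: "weight n x \<le> n"
  unfolding weight_def using card_mono[of "{..<n}" "{i \<in> {..<n}. x i = -1}"] by auto

text \<open>On {-1, 1} the indicator of -1 is (1 - y) / 2, so the weight is affine in the
  coordinates and its spectral norm can be estimated term by term.\<close>

lemma weight_eq_sum:
  assumes "x \<in> cube n"
  shows "real (weight n x) = real n / 2 + (\<Sum>i<n. - 1 / 2 * x i)"
proof -
  have "real (weight n x) = (\<Sum>i<n. if x i = -1 then 1 else 0)"
    by (simp add: weight_def sum.If_cases Int_def)
  also have "\<dots> = (\<Sum>i<n. 1 / 2 + - 1 / 2 * x i)"
  proof (intro sum.cong refl)
    fix i assume "i \<in> {..<n}"
    then have "x i \<in> {-1, 1}"
      using assms by (auto simp only: cube_def dest: PiE_mem)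
    then show "(if x i = -1 then 1 else 0) = 1 / 2 + - 1 / 2 * x i" by auto
  qed
  finally show ?thesis by (simp only: sum.distrib) simp
qed

text \<open>The n linear terms contribute 1/2 each, and the constant term n/2 - a has absolute value
  at most n/2 because a lies in [0, n]. The interpolation nodes are kept in that range for this
  reason.\<close>

lemma spectral_norm_weight_diff:
  assumes "0 \<le> a" "a \<le> real n"
  shows "spectral_norm n (\<lambda>x. real (weight n x) - a) \<le> real n"
proof -
  have "spectral_norm n (\<lambda>x. real (weight n x) - a)
      = spectral_norm n (\<lambda>x. (real n / 2 - a) + (\<Sum>i<n. - 1 / 2 * x i))"
    by (rule spectral_norm_cong) (simp add: weight_eq_sum)
  also have "\<dots> \<le> \<bar>real n / 2 - a\<bar> + (\<Sum>i<n. spectral_norm n (\<lambda>x. - 1 / 2 * x i))"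
    using spectral_norm_add[of n "\<lambda>x. real n / 2 - a" "\<lambda>x. \<Sum>i<n. - 1 / 2 * x i"]
      spectral_norm_sum[of n "\<lambda>i x. - 1 / 2 * x i" "{..<n}"]
    by (simp add: spectral_norm_const)
  also have "(\<Sum>i<n. spectral_norm n (\<lambda>x. - 1 / 2 * x i)) = (\<Sum>i<n. 1 / 2)"
    by (intro sum.cong refl, subst spectral_norm_cmult) (simp add: spectral_norm_coordinate)
  also have "\<bar>real n / 2 - a\<bar> + (\<Sum>i<n. 1 / 2) \<le> real n"
    using assms by (simp add: abs_le_iff)
  finally show ?thesis by simp
qed

section \<open>Lagrange interpolation at equally spaced integers\<close>

lemma poly_Lagrange_interpolation:
  fixes q :: "'a :: field poly"
  assumes fin: "finite N" and deg: "degree q < card N"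
  shows "poly q x = (\<Sum>a\<in>N. poly q a * (\<Prod>b\<in>N - {a}. (x - b) / (a - b)))"
proof -
  \<comment> \<open>Lagrange basis: for \<open>a\<close> in \<open>N\<close>, the polynomial
    \<open>L a\<close> has degree at most \<open>card N - 1\<close>, is 1 at \<open>a\<close> and 0
    at the other points of \<open>N\<close>.\<close>
  define L where "L = (\<lambda>a. smult (1 / (\<Prod>b\<in>N - {a}. a - b)) (\<Prod>b\<in>N - {a}. [:- b, 1:]))"
  have poly_L: "poly (L a) y = (\<Prod>b\<in>N - {a}. (y - b) / (a - b))" for a y
    by (simp add: L_def poly_prod prod_dividef)
  have "degree (L a) \<le> card N - 1" if "a \<in> N" for a
  proof -
    have "degree (\<Prod>b\<in>N - {a}. [:- b, 1:]) \<le> (\<Sum>b\<in>N - {a}. 1)"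
      using degree_prod_sum_le[of "N - {a}" "\<lambda>b. [:- b, 1:]"] fin by (simp add: o_def)
    then show ?thesis
      unfolding L_def using that fin degree_smult_le le_trans by fastforce
  qed
  then have "degree (\<Sum>a\<in>N. smult (poly q a) (L a)) \<le> card N - 1"
    using fin by (intro degree_sum_le) (auto intro: order_trans[OF degree_smult_le])
  then have deg': "degree (\<Sum>a\<in>N. smult (poly q a) (L a)) < card N"
    using deg by simp
  \<comment> \<open>Both polynomials have degree below \<open>card N\<close> and agree on
    \<open>N\<close>, so they coincide.\<close>
  have "q = (\<Sum>a\<in>N. smult (poly q a) (L a))"
  proof (rule poly_eqI_degree[where A = N, OF _ deg deg'])
    fix y assume y: "y \<in> N"
    have "poly (L a) y = (if a = y then 1 else 0)" if "a \<in> N" for a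
      using y that fin by (auto simp: poly_L intro!: prod.neutral prod_zero)
    then have "(\<Sum>a\<in>N. poly q a * poly (L a) y) = (\<Sum>a\<in>N. if a = y then poly q a else 0)"
      by (intro sum.cong refl) auto
    then show "poly q y = poly (\<Sum>a\<in>N. smult (poly q a) (L a)) y"
      using y fin by (simp add: poly_sum)
  qed
  then have "poly q x = poly (\<Sum>a\<in>N. smult (poly q a) (L a)) x" by simp
  then show ?thesis by (simp add: poly_sum poly_L)
qed

text \<open>The quotient d^d / d! is a single term of the series of e^d, whose terms are all
  nonnegative, and e \<le> 3.\<close>

lemma power_self_le_fact: "real d ^ d \<le> 3 ^ d * fact d"
proof -
  have "real d ^ d /\<^sub>R fact d \<le> exp (real d)"
    using sum_le_suminf[OF summable_exp_generic[of "real d"], of "{d}"] by (simp add: exp_def)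
  also have "\<dots> = exp 1 ^ d"
    by (simp add: exp_of_nat_mult[symmetric])
  also have "\<dots> \<le> 3 ^ d"
    by (intro power_mono exp_le) simp
  finally show ?thesis by (simp add: field_simps)
qed

text \<open>The indices below \<open>j\<close> are at distances 1, ..., j and those above at
  distances 1, ..., d - j. Up to sign, this is the denominator of a Lagrange basis polynomial on
  nodes of unit spacing.\<close>

lemma prod_abs_diff_eq_fact:
  assumes "j \<le> d"
  shows "(\<Prod>l\<in>{..d} - {j}. \<bar>real j - real l\<bar>) = fact j * fact (d - j)"
proof -
  have "{..d} - {j} = {..<j} \<union> {j<..d}" using assms by auto
  then have "(\<Prod>l\<in>{..d} - {j}. \<bar>real j - real l\<bar>)
      = (\<Prod>l\<in>{..<j}. \<bar>real j - real l\<bar>) * (\<Prod>l\<in>{j<..d}. \<bar>real j - real l\<bar>)"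
    by (simp add: prod.union_disjoint disjoint_iff)
  also have "(\<Prod>l\<in>{..<j}. \<bar>real j - real l\<bar>) = (\<Prod>l\<in>{1..j}. real l)"
    by (rule prod.reindex_bij_witness[where i = "\<lambda>l. j - l" and j = "\<lambda>l. j - l"]) auto
  also have "(\<Prod>l\<in>{j<..d}. \<bar>real j - real l\<bar>) = (\<Prod>l\<in>{1..d - j}. real l)"
    by (rule prod.reindex_bij_witness[where i = "\<lambda>l. j + l" and j = "\<lambda>l. l - j"]) auto
  finally show ?thesis by (simp add: fact_prod)
qed

text \<open>The nodes are the multiples j * s with j \<le> d and s = n div d; they are integers
  because \<open>bound\<close> speaks of integers only. In 12 = 2 * 2 * 3, one factor 2 comes from
  rounding the spacing n/d down, the other from a row sum of binomial coefficients, and 3 from d^d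
  \<le> 3^d d!.\<close>

lemma spectral_norm_poly_weight:
  assumes "0 < d" "d \<le> n" and deg: "degree q \<le> d"
    and bound: "\<And>t. t \<le> n \<Longrightarrow> \<bar>poly q (real t)\<bar> \<le> B"
  shows "spectral_norm n (\<lambda>x. poly q (real (weight n x))) \<le> B * 12 ^ d"
proof -
  define s where "s = n div d"
  have s: "0 < s" "d * s \<le> n"
    using assms(1,2) by (auto simp: s_def div_greater_zero_iff)
  \<comment> \<open>Rounding down costs at most a factor 2: since s \<ge> 1, the remainder is below
    d \<le> d * s.\<close>
  have "n < d * s + d"
    unfolding s_def using dividend_less_times_div[OF assms(1), of n] by simp
  also have "\<dots> \<le> 2 * d * s" using s(1) by simp
  finally have ns: "real n \<le> 2 * real d * real s"
    by (metis less_imp_le of_nat_le_iff of_nat_mult of_nat_numeral)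
  define v where "v = (\<lambda>j. real (j * s))"
  have inj: "inj_on v A" for A using s by (auto simp: v_def inj_on_def)
  have v: "0 \<le> v j" "v j \<le> real n" if "j \<le> d" for j
    using order_trans[OF mult_le_mono1[OF that, of s] s(2)] by (simp_all add: v_def del: of_nat_mult)
  have B: "0 \<le> B" using bound[of 0] by linarith
  have interp: "poly q y = (\<Sum>j\<le>d. poly q (v j) * (\<Prod>l\<in>{..d} - {j}. (y - v l) / (v j - v l)))" for y
  proof -
    have "poly q y = (\<Sum>a\<in>v ` {..d}. poly q a * (\<Prod>b\<in>v ` {..d} - {a}. (y - b) / (a - b)))"
      using deg by (intro poly_Lagrange_interpolation) (auto simp: card_image[OF inj])
    also have "\<dots> = (\<Sum>j\<le>d. poly q (v j) * (\<Prod>b\<in>v ` ({..d} - {j}). (y - b) / (v j - b)))"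
      by (subst sum.reindex[OF inj], unfold o_def, intro sum.cong refl)
         (simp add: inj_on_image_set_diff[OF inj[of UNIV]])
    finally show ?thesis by (simp add: prod.reindex[OF inj])
  qed
  have term_bound: "spectral_norm n (\<lambda>x. poly q (v j) *
      (\<Prod>l\<in>{..d} - {j}. (real (weight n x) - v l) / (v j - v l)))
      \<le> B * ((2 * real d) ^ d / (fact j * fact (d - j)))" if j: "j \<le> d" for j
  proof -
    have "spectral_norm n (\<lambda>x. \<Prod>l\<in>{..d} - {j}. (real (weight n x) - v l) / (v j - v l))
        \<le> (\<Prod>l\<in>{..d} - {j}. spectral_norm n (\<lambda>x. (real (weight n x) - v l) / (v j - v l)))"
      by (rule spectral_norm_prod)
    also have "\<dots> \<le> (\<Prod>l\<in>{..d} - {j}. 2 * real d / \<bar>real j - real l\<bar>)"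
    proof (intro prod_mono conjI spectral_norm_nonneg)
      fix l assume l: "l \<in> {..d} - {j}"
      have "spectral_norm n (\<lambda>x. (real (weight n x) - v l) / (v j - v l))
          = spectral_norm n (\<lambda>x. real (weight n x) - v l) / \<bar>v j - v l\<bar>"
        using spectral_norm_cmult[of n "1 / (v j - v l)" "\<lambda>x. real (weight n x) - v l"] by simp
      \<comment> \<open>The node \<open>v l\<close> lies in [0, n], so the numerator has norm at
        most n \<le> 2 d s. The spacing s then cancels against the one in the denominator.\<close>
      also have "\<dots> \<le> 2 * real d * real s / \<bar>v j - v l\<bar>"
        using l v ns by (intro divide_right_mono order_trans[OF spectral_norm_weight_diff]) auto
      also have "\<bar>v j - v l\<bar> = \<bar>real j - real l\<bar> * real s"
        by (simp add: v_def abs_mult flip: left_diff_distrib)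
      finally show "spectral_norm n (\<lambda>x. (real (weight n x) - v l) / (v j - v l))
          \<le> 2 * real d / \<bar>real j - real l\<bar>"
        using s(1) by simp
    qed
    \<comment> \<open>The index set \<open>{..d} - {j}\<close> has d elements, hence the exponent
      d.\<close>
    also have "\<dots> = (2 * real d) ^ d / (fact j * fact (d - j))"
      using j by (simp add: prod_dividef prod_abs_diff_eq_fact)
    finally have le: "spectral_norm n (\<lambda>x. \<Prod>l\<in>{..d} - {j}. (real (weight n x) - v l) / (v j - v l))
        \<le> (2 * real d) ^ d / (fact j * fact (d - j))" .
    have "j * s \<le> n" using v(2)[OF j] by (simp add: v_def flip: of_nat_mult)
    then have "\<bar>poly q (v j)\<bar> \<le> B" unfolding v_def by (rule bound)
    then show ?thesis
      unfolding spectral_norm_cmult using le B by (intro mult_mono spectral_norm_nonneg) auto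
  qed
  have "spectral_norm n (\<lambda>x. poly q (real (weight n x)))
      \<le> (\<Sum>j\<le>d. spectral_norm n (\<lambda>x. poly q (v j) *
          (\<Prod>l\<in>{..d} - {j}. (real (weight n x) - v l) / (v j - v l))))"
    by (subst interp) (rule spectral_norm_sum)
  also have "\<dots> \<le> (\<Sum>j\<le>d. B * ((2 * real d) ^ d / (fact j * fact (d - j))))"
    using term_bound by (intro sum_mono) auto
  \<comment> \<open>Writing 1 / (j! (d - j)!) as (d choose j) / d! turns the sum over j into a row
    of Pascal's triangle, whose total is 2^d.\<close>
  also have "\<dots> = (\<Sum>j\<le>d. B * (2 * real d) ^ d / fact d * real (d choose j))"
    by (intro sum.cong refl) (simp add: binomial_fact field_simps)
  also have "\<dots> = B * (2 * real d) ^ d / fact d * 2 ^ d"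
    using choose_row_sum[of d] by (subst sum_distrib_left[symmetric]) (simp flip: of_nat_sum)
  also have "\<dots> = B * 4 ^ d * (real d ^ d / fact d)"
    using power_mult_distrib[of 2 "2 :: real" d] by (simp add: power_mult_distrib)
  also have "\<dots> \<le> B * 4 ^ d * 3 ^ d"
    using B power_self_le_fact[of d] by (intro mult_left_mono) (auto simp: divide_le_eq)
  also have "\<dots> = B * 12 ^ d"
    by (simp add: mult.assoc flip: power_mult_distrib)
  finally show ?thesis .
qed

section \<open>Points of the cube by weight\<close>

definition sign_vector :: "nat \<Rightarrow> nat set \<Rightarrow> nat \<Rightarrow> real" where
  "sign_vector n A = (\<lambda>i\<in>{..<n}. if i \<in> A then -1 else 1)"

lemma sign_vector_in_cube: "sign_vector n A \<in> cube n"
  by (auto simp: sign_vector_def cube_def)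

lemma weight_sign_vector: "A \<subseteq> {..<n} \<Longrightarrow> weight n (sign_vector n A) = card A"
  unfolding weight_def by (rule arg_cong[where f = card]) (auto simp: sign_vector_def)

text \<open>Points of equal weight have the same multiset of entries, so a permutation of the
  coordinates carries one to the other.\<close>

lemma symmetric_function_weight:
  assumes f: "symmetric_function n f" and x: "x \<in> cube n" and y: "y \<in> cube n"
    and w: "weight n x = weight n y"
  shows "f x = f y"
proof -
  have msets: "image_mset z (mset_set {..<n})
      = replicate_mset (weight n z) (-1) + replicate_mset (n - weight n z) 1"
    if z: "z \<in> cube n" for z
  proof -
    let ?A = "{i \<in> {..<n}. z i = -1}"
    have "mset_set {..<n} = mset_set ?A + mset_set ({..<n} - ?A)"
      by (subst mset_set_Union[symmetric]) (auto intro!: arg_cong[where f = mset_set])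
    moreover have "image_mset z (mset_set ?A) = image_mset (\<lambda>_. -1) (mset_set ?A)"
      by (intro image_mset_cong) auto
    moreover have "image_mset z (mset_set ({..<n} - ?A)) = image_mset (\<lambda>_. 1) (mset_set ({..<n} - ?A))"
      using z by (intro image_mset_cong) (auto simp: cube_def dest: PiE_mem)
    moreover have "card ({..<n} - ?A) = n - card ?A"
      by (subst card_Diff_subset) auto
    ultimately show ?thesis
      by (simp add: image_mset_const_eq weight_def)
  qed
  have "image_mset x (mset_set {..<n}) = image_mset y (mset_set {..<n})"
    using msets[OF x] msets[OF y] w by simp
  then obtain \<sigma> where \<sigma>: "\<sigma> permutes {..<n}" "\<forall>i\<in>{..<n}. x i = y (\<sigma> i)"
    using image_mset_eq_implies_permutes[of "{..<n}" x y] by auto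
  have "x = (\<lambda>i. y (\<sigma> i))"
  proof
    fix i show "x i = y (\<sigma> i)"
    proof (cases "i < n")
      \<comment> \<open>Outside the index range \<sigma> fixes \<open>i\<close>, and both points
        take the value \<open>undefined\<close> there, being extensional.\<close>
      case False
      then have "\<sigma> i = i" using \<sigma>(1) by (simp add: permutes_not_in)
      then show ?thesis using False x y by (simp add: cube_def PiE_def extensional_def)
    qed (use \<sigma>(2) in simp)
  qed
  then show ?thesis using f \<sigma>(1) y unfolding symmetric_function_def by simp
qed

section \<open>Averages over the levels of the cube\<close>

definition level_mean :: "nat \<Rightarrow> ((nat \<Rightarrow> real) \<Rightarrow> real) \<Rightarrow> nat \<Rightarrow> real" where
  "level_mean n h t = (\<Sum>A | A \<subseteq> {..<n} \<and> card A = t. h (sign_vector n A)) / real (n choose t)"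

lemma card_level: "card {A. A \<subseteq> {..<n} \<and> card A = t} = n choose t"
  using n_subsets[of "{..<n}" t] by simp

lemma finite_level: "finite {A. A \<subseteq> {..<n::nat} \<and> card A = t}"
  by (rule finite_subset[of _ "Pow {..<n}"]) auto

lemma level_mean_cong:
  "(\<And>x. x \<in> cube n \<Longrightarrow> g x = h x) \<Longrightarrow> level_mean n g t = level_mean n h t"
  by (simp add: level_mean_def sign_vector_in_cube)

lemma level_mean_sum: "level_mean n (\<lambda>x. \<Sum>k\<in>K. h k x) t = (\<Sum>k\<in>K. level_mean n (h k) t)"
  unfolding level_mean_def by (subst sum.swap) (simp add: sum_divide_distrib)

lemma level_mean_cmult: "level_mean n (\<lambda>x. c * h x) t = c * level_mean n h t"
  by (simp add: level_mean_def sum_distrib_left)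

text \<open>Averaging over a nonempty level does not increase the distance to a constant. It serves
  with \<open>c\<close> the common value of a symmetric function on that level.\<close>

lemma abs_level_mean_diff_le:
  assumes t: "t \<le> n" and h: "\<And>x. x \<in> cube n \<Longrightarrow> weight n x = t \<Longrightarrow> \<bar>h x - c\<bar> \<le> e"
  shows "\<bar>level_mean n h t - c\<bar> \<le> e"
proof -
  let ?L = "{A. A \<subseteq> {..<n} \<and> card A = t}"
  have pos: "0 < real (n choose t)" using t by simp
  have "\<bar>\<Sum>A\<in>?L. h (sign_vector n A) - c\<bar> \<le> (\<Sum>A\<in>?L. e)"
    by (rule order_trans[OF sum_abs sum_mono]) (auto intro!: h sign_vector_in_cube weight_sign_vector)
  then have "\<bar>(\<Sum>A\<in>?L. h (sign_vector n A)) - real (n choose t) * c\<bar> \<le> real (n choose t) * e"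
    by (simp add: sum_subtractf card_level)
  moreover have "level_mean n h t - c
      = ((\<Sum>A\<in>?L. h (sign_vector n A)) - real (n choose t) * c) / real (n choose t)"
    using pos by (simp add: level_mean_def diff_divide_distrib)
  ultimately show ?thesis
    using pos by (simp add: abs_divide pos_divide_le_eq mult.commute)
qed

text \<open>Removing \<open>T\<close> matches its supersets of size \<open>t\<close> with the
  subsets of \<open>U - T\<close> of size \<open>t - card T\<close>. Cross-multiplication keeps the
  count in the natural numbers. If \<open>T\<close> has more than \<open>t\<close> elements, both
  sides vanish.\<close>

lemma card_supersets_of_card:
  assumes fin: "finite U" and T: "T \<subseteq> U" and t: "t \<le> card U"
  shows "card {A. A \<subseteq> U \<and> card A = t \<and> T \<subseteq> A} * (card U choose card T)
       = (card U choose t) * (t choose card T)"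
proof (cases "card T \<le> t")
  case True
  have finT: "finite T" using T fin finite_subset by blast
  have "card {A. A \<subseteq> U \<and> card A = t \<and> T \<subseteq> A} = card {B. B \<subseteq> U - T \<and> card B = t - card T}"
  proof (rule bij_betw_same_card)
    show "bij_betw (\<lambda>A. A - T) {A. A \<subseteq> U \<and> card A = t \<and> T \<subseteq> A} {B. B \<subseteq> U - T \<and> card B = t - card T}"
    proof (rule bij_betw_byWitness[where f' = "\<lambda>B. B \<union> T"])
      show "(\<lambda>B. B \<union> T) ` {B. B \<subseteq> U - T \<and> card B = t - card T} \<subseteq> {A. A \<subseteq> U \<and> card A = t \<and> T \<subseteq> A}"
      proof clarify
        fix B assume B: "B \<subseteq> U - T" "card B = t - card T"
        have "card (B \<union> T) = card B + card T"
          using B fin finT by (intro card_Un_disjoint) (auto intro: finite_subset)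
        then show "B \<union> T \<subseteq> U \<and> card (B \<union> T) = t \<and> T \<subseteq> B \<union> T"
          using B T True by auto
      qed
    qed (use finT in \<open>auto simp: card_Diff_subset\<close>)
  qed
  also have "\<dots> = (card U - card T) choose (t - card T)"
    using fin T finT by (subst n_subsets) (simp_all add: card_Diff_subset)
  finally show ?thesis
    using choose_mult[OF True t] by (simp add: mult.commute)
next
  case False
  have "{A. A \<subseteq> U \<and> card A = t \<and> T \<subseteq> A} = {}"
  proof (intro Collect_empty_eq[THEN iffD2] allI notI, elim conjE)
    fix A assume "A \<subseteq> U" "card A = t" "T \<subseteq> A"
    then show False using False card_mono[of A T] finite_subset[of A U] fin by simp
  qed
  then have "card {A. A \<subseteq> U \<and> card A = t \<and> T \<subseteq> A} = 0" by (metis card.empty)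
  then show ?thesis using False by (simp add: binomial_eq_0)
qed

text \<open>A factor x i - 1 vanishes at 1 and equals -2 at -1, so only the sets containing
  \<open>T\<close> contribute. After division by the size of the level, \<open>t\<close> enters only
  through \<open>t choose card T\<close>, which is polynomial in \<open>t\<close>.\<close>

lemma level_mean_prod_diff_one:
  assumes "T \<subseteq> {..<n}" "t \<le> n"
  shows "level_mean n (\<lambda>x. \<Prod>i\<in>T. x i - 1) t
       = (- 2) ^ card T * real (t choose card T) / real (n choose card T)"
proof -
  have finT: "finite T" using assms(1) finite_subset by auto
  let ?L = "{A. A \<subseteq> {..<n} \<and> card A = t}"
  have "(\<Prod>i\<in>T. sign_vector n A i - 1) = (if T \<subseteq> A then (- 2) ^ card T else 0)" for A
  proof (cases "T \<subseteq> A")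
    case True
    then have "(\<Prod>i\<in>T. sign_vector n A i - 1) = (\<Prod>i\<in>T. - 2)"
      using assms(1) by (intro prod.cong refl) (auto simp: sign_vector_def)
    then show ?thesis using True by simp
  next
    case False
    then obtain i where "i \<in> T" "i \<notin> A" by blast
    then show ?thesis
      using False assms(1) finT by (auto intro!: bexI[of _ i] simp: prod_zero_iff sign_vector_def)
  qed
  then have "(\<Sum>A\<in>?L. \<Prod>i\<in>T. sign_vector n A i - 1)
      = (\<Sum>A\<in>{A \<in> ?L. T \<subseteq> A}. (- 2) ^ card T)"
    by (subst sum.inter_filter[OF finite_level]) simp
  also have "{A \<in> ?L. T \<subseteq> A} = {A. A \<subseteq> {..<n} \<and> card A = t \<and> T \<subseteq> A}" by auto
  finally have "(\<Sum>A\<in>?L. \<Prod>i\<in>T. sign_vector n A i - 1)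
      = real (card {A. A \<subseteq> {..<n} \<and> card A = t \<and> T \<subseteq> A}) * (- 2) ^ card T"
    by simp
  moreover have "real (card {A. A \<subseteq> {..<n} \<and> card A = t \<and> T \<subseteq> A}) * real (n choose card T)
      = real (n choose t) * real (t choose card T)"
    using card_supersets_of_card[OF _ assms(1), of t] assms(2)
    by (simp flip: of_nat_mult)
  moreover have "real (n choose card T) \<noteq> 0" "real (n choose t) \<noteq> 0"
    using assms card_mono[of "{..<n}" T] by simp_all
  ultimately show ?thesis
    unfolding level_mean_def by (simp add: divide_simps)
qed

text \<open>The falling factorial divided by k!; its zeros 0, ..., k - 1 account for the case t <
  k.\<close>

lemma binomial_as_poly:
  "\<exists>q :: real poly. degree q \<le> k \<and> (\<forall>t. poly q (real t) = real (t choose k))"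
proof (intro exI conjI allI)
  let ?q = "smult (1 / fact k) (\<Prod>i<k. [:- real i, 1:])"
  show "degree ?q \<le> k"
    using degree_prod_sum_le[of "{..<k}" "\<lambda>i. [:- real i, 1:]"] by (simp add: o_def)
  show "poly ?q (real t) = real (t choose k)" for t
    by (simp add: poly_prod binomial_gbinomial gbinomial_prod_rev atLeast0LessThan)
qed

text \<open>Minsky-Papert symmetrization as a property of \<open>h\<close>, so that it can be
  established for characters and extended by linearity.\<close>

definition poly_level_mean :: "nat \<Rightarrow> nat \<Rightarrow> ((nat \<Rightarrow> real) \<Rightarrow> real) \<Rightarrow> bool" where
  "poly_level_mean n d h \<longleftrightarrow>
     (\<exists>q. degree q \<le> d \<and> (\<forall>t\<le>n. level_mean n h t = poly q (real t)))"

lemma poly_level_mean_cong: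
  "(\<And>x. x \<in> cube n \<Longrightarrow> g x = h x) \<Longrightarrow> poly_level_mean n d g \<longleftrightarrow> poly_level_mean n d h"
  unfolding poly_level_mean_def using level_mean_cong[of n g h] by simp

lemma poly_level_mean_cmult:
  assumes "poly_level_mean n d h"
  shows "poly_level_mean n d (\<lambda>x. c * h x)"
proof -
  obtain q where "degree q \<le> d" "\<forall>t\<le>n. level_mean n h t = poly q (real t)"
    using assms unfolding poly_level_mean_def by blast
  then show ?thesis
    unfolding poly_level_mean_def
    by (intro exI[of _ "smult c q"]) (auto simp: level_mean_cmult intro: order_trans[OF degree_smult_le])
qed

lemma poly_level_mean_sum:
  assumes "finite K" "\<And>k. k \<in> K \<Longrightarrow> poly_level_mean n d (h k)"
  shows "poly_level_mean n d (\<lambda>x. \<Sum>k\<in>K. h k x)"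
proof -
  obtain q where "\<forall>k\<in>K. degree (q k) \<le> d \<and> (\<forall>t\<le>n. level_mean n (h k) t = poly (q k) (real t))"
    using assms(2) unfolding poly_level_mean_def by metis
  then show ?thesis
    unfolding poly_level_mean_def using assms(1)
    by (intro exI[of _ "\<Sum>k\<in>K. q k"]) (auto simp: level_mean_sum poly_sum intro: degree_sum_le)
qed

text \<open>Writing each x i as (x i - 1) + 1 expands the character into products of the x i - 1
  over the subsets of \<open>S\<close>. The level means of these are multiples of binomial
  polynomials of degree at most \<open>card S\<close>.\<close>

lemma poly_level_mean_character:
  assumes S: "S \<subseteq> {..<n}" and "card S \<le> d"
  shows "poly_level_mean n d (\<lambda>x. \<Prod>i\<in>S. x i)"
proof -
  have finS: "finite S" using S finite_subset by auto
  have "(\<Prod>i\<in>S. x i) = (\<Sum>T\<in>Pow S. \<Prod>i\<in>T. x i - 1)" for x :: "nat \<Rightarrow> real"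
    using prod_add[OF finS, of "\<lambda>i. x i - 1" "\<lambda>_. 1"] by simp
  moreover have "poly_level_mean n d (\<lambda>x. \<Sum>T\<in>Pow S. \<Prod>i\<in>T. x i - 1)"
  proof (rule poly_level_mean_sum)
    fix T assume T: "T \<in> Pow S"
    then have Tn: "T \<subseteq> {..<n}" using S by auto
    have "card T \<le> d" using T assms(2) card_mono[OF finS, of T] by simp
    moreover obtain q :: "real poly" where
      "degree q \<le> card T" "\<And>t. poly q (real t) = real (t choose card T)"
      using binomial_as_poly by blast
    \<comment> \<open>The scalar collects the factors from \<open>level_mean_prod_diff_one\<close>
      that are independent of \<open>t\<close>.\<close>
    ultimately show "poly_level_mean n d (\<lambda>x. \<Prod>i\<in>T. x i - 1)"
      unfolding poly_level_mean_def
      by (intro exI[of _ "smult ((- 2) ^ card T / real (n choose card T)) q"])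
         (auto simp: level_mean_prod_diff_one[OF Tn] intro: order_trans[OF degree_smult_le])
  qed (use finS in simp)
  ultimately show ?thesis by simp
qed

section \<open>Multivariate polynomials and the approximate degree\<close>

lemma mpoly_degree_bound:
  "m \<in> Poly_Mapping.keys P \<Longrightarrow>
    (\<Sum>i\<in>Poly_Mapping.keys m. Poly_Mapping.lookup m i) \<le> mpoly_degree P"
  unfolding mpoly_degree_def by (intro Max_ge) auto

text \<open>On the cube even powers of a coordinate are 1 and odd powers reduce to the coordinate,
  so each monomial agrees with a character of no larger degree. Linearity does the rest.\<close>

lemma poly_level_mean_mpoly_eval:
  assumes P: "mpoly_in n P"
  shows "poly_level_mean n (mpoly_degree P) (mpoly_eval P)"
  unfolding mpoly_eval_def
proof (intro poly_level_mean_sum poly_level_mean_cmult)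
  fix m assume m: "m \<in> Poly_Mapping.keys P"
  define S where "S = {i \<in> Poly_Mapping.keys m. odd (Poly_Mapping.lookup m i)}"
  have S: "S \<subseteq> {..<n}" using P m by (auto simp: S_def mpoly_in_def)
  have "(\<Prod>i\<in>Poly_Mapping.keys m. x i ^ Poly_Mapping.lookup m i) = (\<Prod>i\<in>S. x i)"
    if x: "x \<in> cube n" for x
  proof -
    have "(\<Prod>i\<in>Poly_Mapping.keys m. x i ^ Poly_Mapping.lookup m i)
        = (\<Prod>i\<in>Poly_Mapping.keys m. if odd (Poly_Mapping.lookup m i) then x i else 1)"
    proof (intro prod.cong refl)
      fix i assume "i \<in> Poly_Mapping.keys m"
      then have "i \<in> {..<n}" using P m by (auto simp: mpoly_in_def)
      then have "x i \<in> {-1, 1}" using x by (auto simp only: cube_def dest: PiE_mem)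
      then show "x i ^ Poly_Mapping.lookup m i = (if odd (Poly_Mapping.lookup m i) then x i else 1)"
        by auto
    qed
    then show ?thesis by (simp add: S_def prod.inter_filter)
  qed
  moreover have "card S \<le> mpoly_degree P"
  proof -
    \<comment> \<open>Every exponent on \<open>S\<close> is odd, hence at least 1.\<close>
    have "card S \<le> (\<Sum>i\<in>S. Poly_Mapping.lookup m i)"
      unfolding card_eq_sum by (intro sum_mono) (auto simp: S_def intro: Suc_leI odd_pos)
    also have "\<dots> \<le> (\<Sum>i\<in>Poly_Mapping.keys m. Poly_Mapping.lookup m i)"
      by (intro sum_mono2) (auto simp: S_def)
    finally show ?thesis using mpoly_degree_bound[OF m] by simp
  qed
  ultimately show "poly_level_mean n (mpoly_degree P)
      (\<lambda>x. \<Prod>i\<in>Poly_Mapping.keys m. x i ^ Poly_Mapping.lookup m i)"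
    using poly_level_mean_character[OF S] poly_level_mean_cong by (metis (no_types, lifting))
qed simp

definition squarefree_monomial :: "nat set \<Rightarrow> nat \<Rightarrow>\<^sub>0 nat" where
  "squarefree_monomial S = Abs_poly_mapping (\<lambda>i. if i \<in> S then 1 else 0)"

lemma lookup_squarefree_monomial:
  "finite S \<Longrightarrow> Poly_Mapping.lookup (squarefree_monomial S) = (\<lambda>i. if i \<in> S then 1 else 0)"
  unfolding squarefree_monomial_def by (rule lookup_Abs_poly_mapping) simp

lemma keys_squarefree_monomial: "finite S \<Longrightarrow> Poly_Mapping.keys (squarefree_monomial S) = S"
  by (simp add: keys.rep_eq lookup_squarefree_monomial)

text \<open>The multilinear expression of \<open>f\<close>, read as a polynomial. It provides a
  candidate for the \<open>LEAST\<close> in \<open>approx_degree\<close> and bounds the approximate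
  degree by n, which keeps the spacing of the interpolation nodes positive.\<close>

lemma function_as_mpoly:
  "\<exists>P. mpoly_in n P \<and> (\<forall>x\<in>cube n. mpoly_eval P x = f x) \<and> mpoly_degree P \<le> n"
proof -
  let ?M = "squarefree_monomial ` Pow {..<n}"
  let ?a = "multilinear_coeff n f"
  have fin: "finite S" if "S \<in> Pow {..<n}" for S
    using that finite_subset by auto
  have inj: "inj_on squarefree_monomial (Pow {..<n})"
    by (metis fin inj_onI keys_squarefree_monomial)
  define P where "P = Abs_poly_mapping (\<lambda>m. if m \<in> ?M then ?a (Poly_Mapping.keys m) else 0)"
  have lookup: "Poly_Mapping.lookup P = (\<lambda>m. if m \<in> ?M then ?a (Poly_Mapping.keys m) else 0)"
    unfolding P_def
    by (rule lookup_Abs_poly_mapping) (rule finite_subset[of _ ?M], auto)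
  have keys: "Poly_Mapping.keys P \<subseteq> ?M"
    by (auto simp: keys.rep_eq lookup split: if_splits)
  have "mpoly_in n P"
    using keys fin keys_squarefree_monomial unfolding mpoly_in_def by blast
  moreover have "mpoly_eval P x = f x" if x: "x \<in> cube n" for x
  proof -
    \<comment> \<open>Monomials with zero coefficient are absent from the keys of \<open>P\<close>;
      summing over all of \<open>?M\<close> adds only zeros.\<close>
    have "mpoly_eval P x = (\<Sum>m\<in>?M. Poly_Mapping.lookup P m *
        (\<Prod>i\<in>Poly_Mapping.keys m. x i ^ Poly_Mapping.lookup m i))"
      unfolding mpoly_eval_def using keys by (intro sum.mono_neutral_left) (auto simp: in_keys_iff)
    also have "\<dots> = (\<Sum>S\<in>Pow {..<n}. ?a S * (\<Prod>i\<in>S. x i))"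
      using fin by (subst sum.reindex[OF inj])
        (auto simp: lookup lookup_squarefree_monomial keys_squarefree_monomial intro!: sum.cong)
    finally show ?thesis using cube_expansion[OF x, of f] by simp
  qed
  moreover have "mpoly_degree P \<le> n"
  proof -
    have "(\<Sum>i\<in>Poly_Mapping.keys m. Poly_Mapping.lookup m i) \<le> n" if m: "m \<in> Poly_Mapping.keys P" for m
    proof -
      obtain S where S: "S \<subseteq> {..<n}" "m = squarefree_monomial S" using subsetD[OF keys m] by auto
      then show ?thesis
        using fin card_mono[of "{..<n}" S]
        by (simp add: lookup_squarefree_monomial keys_squarefree_monomial)
    qed
    then show ?thesis unfolding mpoly_degree_def by (subst Max_le_iff) auto
  qed
  ultimately show ?thesis by blast
qed

lemma approx_degree_attained:
  obtains P where "mpoly_in n P" "approximates n (1 / 3) (mpoly_eval P) f"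
    "mpoly_degree P = approx_degree n f" "approx_degree n f \<le> n"
proof -
  let ?Q = "\<lambda>d. \<exists>P. mpoly_in n P \<and> approximates n (1/3) (mpoly_eval P) f \<and> mpoly_degree P = d"
  obtain P where P: "mpoly_in n P" "\<forall>x\<in>cube n. mpoly_eval P x = f x" "mpoly_degree P \<le> n"
    using function_as_mpoly by blast
  then have Q: "?Q (mpoly_degree P)" by (auto simp: approximates_def)
  have "?Q (approx_degree n f)" unfolding approx_degree_def by (rule LeastI[of ?Q, OF Q])
  moreover have "approx_degree n f \<le> n"
    unfolding approx_degree_def using Least_le[of ?Q, OF Q] P(3) by (rule le_trans)
  ultimately show thesis using that by blast
qed

section \<open>The approximate spectral norm of symmetric functions\<close>

lemma approx_spectral_norm_le:
  assumes "approximates n \<epsilon> p f"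
  shows "approx_spectral_norm n f \<epsilon> \<le> spectral_norm n p"
  unfolding approx_spectral_norm_def
  using assms by (intro cInf_lower bdd_belowI[of _ 0]) (auto simp: spectral_norm_nonneg)

lemma approx_spectral_norm_nonneg:
  assumes "0 \<le> \<epsilon>"
  shows "0 \<le> approx_spectral_norm n f \<epsilon>"
proof -
  have "approximates n \<epsilon> f f" using assms by (simp add: approximates_def)
  then show ?thesis
    unfolding approx_spectral_norm_def by (intro cInf_greatest) (auto simp: spectral_norm_nonneg)
qed

text \<open>A constant factor in front of the power could not be tolerated: at degree 0 the
  logarithmic bound requires a norm of at most 1. Hence the separate treatment of that
  degree.\<close>

lemma approx_spectral_norm_symmetric_le:
  assumes f: "boolean_function n f" "symmetric_function n f"
  shows "approx_spectral_norm n f (1 / 3) \<le> 16 ^ approx_degree n f"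
proof -
  define d where "d = approx_degree n f"
  obtain P where P: "mpoly_in n P" "approximates n (1 / 3) (mpoly_eval P) f"
      "mpoly_degree P = d" and dn: "d \<le> n"
    unfolding d_def using approx_degree_attained by blast
  obtain q where q: "degree q \<le> d" "\<And>t. t \<le> n \<Longrightarrow> level_mean n (mpoly_eval P) t = poly q (real t)"
    using poly_level_mean_mpoly_eval[OF P(1)] P(3) unfolding poly_level_mean_def by auto
  \<comment> \<open>The value of \<open>q\<close> at the weight of \<open>x\<close> is the mean of
    the approximating polynomial over the level of \<open>x\<close>, on which \<open>f\<close> is
    constant.\<close>
  have near: "\<bar>poly q (real (weight n x)) - f x\<bar> \<le> 1 / 3" if x: "x \<in> cube n" for x
    unfolding q(2)[OF weight_le, symmetric]
  proof (rule abs_level_mean_diff_le[OF weight_le])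
    fix y assume y: "y \<in> cube n" "weight n y = weight n x"
    then have "f x = f y" using symmetric_function_weight[OF f(2)] x by metis
    then show "\<bar>mpoly_eval P y - f x\<bar> \<le> 1 / 3" using P(2) y(1) by (simp add: approximates_def)
  qed
  have f_val: "f x = 1 \<or> f x = -1" if "x \<in> cube n" for x
    using f(1) that by (auto simp: boolean_function_def)
  show ?thesis
  proof (cases "d = 0")
    case True
    then obtain c where c: "q = [:c:]" using q(1) degree_eq_zeroE by auto
    let ?o = "sign_vector n {}"
    \<comment> \<open>Two values of \<open>f\<close> within 1/3 of the same number \<open>c\<close>
      differ by at most 2/3; both lie in {-1, 1}, so they coincide.\<close>
    have "f x = f ?o" if x: "x \<in> cube n" for x
      using near[OF x] near[OF sign_vector_in_cube, of "{}"] f_val[OF x]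
        f_val[OF sign_vector_in_cube, of "{}"] by (auto simp: c abs_if split: if_splits)
    then have "approximates n (1 / 3) (\<lambda>x. f ?o) f" by (simp add: approximates_def)
    then have "approx_spectral_norm n f (1 / 3) \<le> \<bar>f ?o\<bar>"
      using approx_spectral_norm_le spectral_norm_const by metis
    then show ?thesis
      using f_val[OF sign_vector_in_cube, of "{}"] True by (auto simp: d_def)
  next
    case False
    have "approx_spectral_norm n f (1 / 3) \<le> spectral_norm n (\<lambda>x. poly q (real (weight n x)))"
      using near by (intro approx_spectral_norm_le) (simp add: approximates_def)
    \<comment> \<open>Each t \<le> n is the weight of some point of the cube, where the value of
      \<open>q\<close> is within 1/3 of a value of \<open>f\<close>; hence the bound 1 +
      1/3.\<close>
    also have "\<dots> \<le> 4 / 3 * 12 ^ d"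
    proof (rule spectral_norm_poly_weight[OF _ dn q(1)])
      fix t assume "t \<le> n"
      then have "weight n (sign_vector n {..<t}) = t" by (simp add: weight_sign_vector)
      then show "\<bar>poly q (real t)\<bar> \<le> 4 / 3"
        using near[OF sign_vector_in_cube, of "{..<t}"] f_val[OF sign_vector_in_cube, of "{..<t}"]
        by (auto simp: abs_if split: if_splits)
    qed (use False in simp)
    \<comment> \<open>Since d \<ge> 1, the factor 4/3 is absorbed into the power, and 4/3 * 12 =
      16.\<close>
    also have "\<dots> \<le> (4 / 3) ^ d * 12 ^ d"
      using False power_increasing[of 1 d "4 / 3 :: real"] by simp
    also have "\<dots> = 16 ^ d" by (simp flip: power_mult_distrib)
    finally show ?thesis by (simp add: d_def)
  qed
qed

theorem lemma6p4:
  shows "\<exists>C::real. C > 0 \<and>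
    (\<forall>n::nat. n > 0 \<longrightarrow>
      (\<forall>f :: (nat \<Rightarrow> real) \<Rightarrow> real.
        boolean_function n f \<and> symmetric_function n f \<longrightarrow>
        log 2 (approx_spectral_norm n f (1/3)) \<le> C * real (approx_degree n f)))"
proof (intro exI[of _ 4] conjI allI impI)
  fix n :: nat and f :: "(nat \<Rightarrow> real) \<Rightarrow> real"
  assume f: "boolean_function n f \<and> symmetric_function n f"
  let ?N = "approx_spectral_norm n f (1/3)"
  show "log 2 ?N \<le> 4 * real (approx_degree n f)"
  \<comment> \<open>At 0 the convention \<open>ln 0 = 0\<close> makes the left side 0; otherwise
    nonnegativity makes the norm positive and the logarithm monotone.\<close>
  proof (cases "?N = 0")
    case False
    then have "0 < ?N" using approx_spectral_norm_nonneg[of "1/3" n f] by simp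
    then have "log 2 ?N \<le> log 2 (16 ^ approx_degree n f)"
      using approx_spectral_norm_symmetric_le f by (intro log_mono) auto
    \<comment> \<open>The witness C = 4 comes from 16 = 2^4.\<close>
    also have "\<dots> = log 2 (2 ^ (4 * approx_degree n f))"
      by (simp add: power_mult)
    also have "\<dots> = 4 * real (approx_degree n f)" by simp
    finally show ?thesis .
  qed (simp add: log_def)
qed simp

end
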